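(* Let $\widetilde{P}=\{p_i,\rho_i\}_{i=1}^m\in\mathcal{E}(r_1,\dots,r_m)$, let $\{\Pi_i\}_{i=1}^m$ be its optimal POVM for minimum error discrimination, and let $\widetilde{Q}=\{q_i,\sigma_i\}_{i=1}^m$ be the ensemble constructed from $\widetilde{P}$ and $\{\Pi_i\}$ as described in the context. Then $\{\Pi_i\}_{i=1}^m$ is the pretty good measurement of $\widetilde{Q}$, i.e. $$\Pi_i=\Big(\sum_{j=1}^m q_j\sigma_j\Big)^{-\frac12}q_i\sigma_i\Big(\sum_{k=1}^m q_k\sigma_k\Big)^{-\frac12},\qquad 1\le i\le m .$$
   Context: Setting: $\mathcal{H}$ is a complex Hilbert space of finite dimension $n$; $r_1\ge r_2\ge\dots\ge r_m\ge 1$ are integers with $\sum_{i=1}^m r_i=n$. $\mathcal{E}(r_1,\dots,r_m)$ is the set of (ordered) ensembles $\{p_i,\rho_i\}_{i=1}^m$ with $p_i>0$, $\sum_i p_i=1$, $\rho_i$ density operators on $\mathcal{H}$ with $\mathrm{rank}(\rho_i)=r_i$, and supports $\mathrm{supp}(\rho_1),\dots,\mathrm{supp}(\rho_m)$ linearly independent and together spanning $\mathcal{H}$. An $m$-element POVM is a family $\{\Pi_i\}_{i=1}^m$ with $\Pi_i\ge 0$, $\sum_i\Pi_i=\mathbb{1}$; it is optimal for minimum error discrimination (MED) of $\{p_i,\rho_i\}$ if it maximizes $\sum_i p_i\mathrm{Tr}(\rho_i\Pi_i)$ over all $m$-element POVMs. Known fact: for an ensemble in $\mathcal{E}(r_1,\dots,r_m)$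 the optimal POVM is unique and is a projective measurement with $\mathrm{rank}(\Pi_i)=r_i$. Construction of $\widetilde{Q}$ from $\widetilde{P}$: choose a decomposition $p_i\rho_i=\sum_{j=1}^{r_i}|\widetilde{\psi}_{ij}\rangle\langle\widetilde{\psi}_{ij}|$ into unnormalized pure states for each $i$, and an orthonormal basis $\{|w_{ij}\rangle\}_{j=1}^{r_i}$ of $\mathrm{supp}(\Pi_i)$ such that the $r_i\times r_i$ matrix $(X^{(ii)})_{jk}=\langle\widetilde{\psi}_{ij}|w_{ik}\rangle$ is positive semidefinite (it is then positive definite). Put $|\widetilde{\chi}_{ij}\rangle=\sum_{k=1}^{r_i}(X^{(ii)})_{kj}|\widetilde{\psi}_{ik}\rangle$ and define $$\sigma_i=\frac{\sum_{j=1}^{r_i}|\widetilde{\chi}_{ij}\rangle\langle\widetilde{\chi}_{ij}|}{\sum_{k=1}^{r_i}\langle\widetilde{\chi}_{ik}|\widetilde{\chi}_{ik}\rangle},\qquad q_i=\frac{\sum_{j=1}^{r_i}\langle\widetilde{\chi}_{ij}|\widetilde{\chi}_{ij}\rangle}{\sum_{l=1}^m\sum_{k=1}^{r_l}\langle\widetilde{\chi}_{lk}|\widetilde{\chi}_{lk}\rangle}.$$ *)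

theory Defs
  imports "HOL-Analysis.Analysis"
begin

text \<open>
  The Hilbert space of dimension \<open>n\<close> is \<open>complex ^ 'n\<close> with \<open>n = CARD('n)\<close>; operators on it are
  matrices \<open>complex ^ 'n ^ 'n\<close>.  Families indexed by \<open>1, ..., m\<close> are functions on \<open>nat\<close> of
  which only the values on \<open>{1..m}\<close> are relevant.
\<close>

(* Conjugate-linear in the first argument. The library's inner product on complex ^ 'n is the
   real one, Re (cinner u v). *)
definition cinner :: "complex ^ 'n \<Rightarrow> complex ^ 'n \<Rightarrow> complex" where
  "cinner u v = (\<Sum>a\<in>UNIV. cnj (u $ a) * v $ a)"

definition ketbra :: "complex ^ 'n \<Rightarrow> complex ^ 'n \<Rightarrow> complex ^ 'n ^ 'n" where
  "ketbra u v = (\<chi> a b. u $ a * cnj (v $ b))"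

(* Over the complex numbers a real quadratic form already forces the operator to be Hermitian. *)
definition psd :: "complex ^ 'n ^ 'n \<Rightarrow> bool" where
  "psd A \<longleftrightarrow> (\<forall>v. cinner v (A *v v) \<in> \<real>\<^sub>\<ge>\<^sub>0)"

(* psd for the r x r matrix with entries X j k, 1 <= j, k <= r. *)
definition psd_upto :: "nat \<Rightarrow> (nat \<Rightarrow> nat \<Rightarrow> complex) \<Rightarrow> bool" where
  "psd_upto r X \<longleftrightarrow>
     (\<forall>c :: nat \<Rightarrow> complex. (\<Sum>j=1..r. \<Sum>k=1..r. cnj (c j) * X j k * c k) \<in> \<real>\<^sub>\<ge>\<^sub>0)"

definition psd_sqrt :: "complex ^ 'n ^ 'n \<Rightarrow> complex ^ 'n ^ 'n" where
  "psd_sqrt A = (THE B. psd B \<and> B ** B = A)"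

(* Only meaningful for positive definite A. *)
definition inv_sqrt :: "complex ^ 'n ^ 'n \<Rightarrow> complex ^ 'n ^ 'n" where
  "inv_sqrt A = matrix_inv (psd_sqrt A)"

(* The orthogonal complement of the kernel. *)
definition supp :: "complex ^ 'n ^ 'n \<Rightarrow> (complex ^ 'n) set" where
  "supp A = {v. \<forall>u. A *v u = 0 \<longrightarrow> cinner u v = 0}"

definition density_operator :: "complex ^ 'n ^ 'n \<Rightarrow> bool" where
  "density_operator A \<longleftrightarrow> psd A \<and> trace A = 1"

definition independent_subspaces :: "nat \<Rightarrow> (nat \<Rightarrow> (complex ^ 'n) set) \<Rightarrow> bool" where
  "independent_subspaces m V \<longleftrightarrow>
     (\<forall>v. (\<forall>i\<in>{1..m}. v i \<in> V i) \<and> (\<Sum>i=1..m. v i) = 0 \<longrightarrow> (\<forall>i\<in>{1..m}. v i = 0))"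

definition rank_profile :: "nat \<Rightarrow> nat \<Rightarrow> (nat \<Rightarrow> nat) \<Rightarrow> bool" where
  "rank_profile n m r \<longleftrightarrow>
     (\<forall>i\<in>{1..m}. \<forall>j\<in>{1..m}. i \<le> j \<longrightarrow> r j \<le> r i) \<and> (\<forall>i\<in>{1..m}. 1 \<le> r i) \<and> (\<Sum>i=1..m. r i) = n"

(* Membership of {p_i, rho_i} in E(r_1, ..., r_m). *)
definition ensemble :: "nat \<Rightarrow> (nat \<Rightarrow> nat) \<Rightarrow> (nat \<Rightarrow> real) \<Rightarrow> (nat \<Rightarrow> complex ^ 'n ^ 'n) \<Rightarrow> bool" where
  "ensemble m r p \<rho> \<longleftrightarrow>
     (\<forall>i\<in>{1..m}. 0 < p i) \<and> (\<Sum>i=1..m. p i) = 1 \<and>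
     (\<forall>i\<in>{1..m}. density_operator (\<rho> i) \<and> rank (\<rho> i) = r i) \<and>
     independent_subspaces m (\<lambda>i. supp (\<rho> i)) \<and>
     vec.span (\<Union>i\<in>{1..m}. supp (\<rho> i)) = UNIV"

definition povm :: "nat \<Rightarrow> (nat \<Rightarrow> complex ^ 'n ^ 'n) \<Rightarrow> bool" where
  "povm m M \<longleftrightarrow> (\<forall>i\<in>{1..m}. psd (M i)) \<and> (\<Sum>i=1..m. M i) = mat 1"

(* The traces are real for psd arguments, so Re loses nothing. *)
definition success_prob ::
  "nat \<Rightarrow> (nat \<Rightarrow> real) \<Rightarrow> (nat \<Rightarrow> complex ^ 'n ^ 'n) \<Rightarrow> (nat \<Rightarrow> complex ^ 'n ^ 'n) \<Rightarrow> real" where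
  "success_prob m p \<rho> M = (\<Sum>i=1..m. p i * Re (trace (\<rho> i ** M i)))"

definition optimal_povm ::
  "nat \<Rightarrow> (nat \<Rightarrow> real) \<Rightarrow> (nat \<Rightarrow> complex ^ 'n ^ 'n) \<Rightarrow> (nat \<Rightarrow> complex ^ 'n ^ 'n) \<Rightarrow> bool" where
  "optimal_povm m p \<rho> M \<longleftrightarrow>
     povm m M \<and> (\<forall>M'. povm m M' \<longrightarrow> success_prob m p \<rho> M' \<le> success_prob m p \<rho> M)"

definition orthonormal_basis_of :: "nat \<Rightarrow> (nat \<Rightarrow> complex ^ 'n) \<Rightarrow> (complex ^ 'n) set \<Rightarrow> bool" where
  "orthonormal_basis_of d w V \<longleftrightarrow>
     (\<forall>j\<in>{1..d}. \<forall>k\<in>{1..d}. cinner (w j) (w k) = (if j = k then 1 else 0)) \<and>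
     vec.span (w ` {1..d}) = V"

definition X_entry ::
  "(nat \<Rightarrow> nat \<Rightarrow> complex ^ 'n) \<Rightarrow> (nat \<Rightarrow> nat \<Rightarrow> complex ^ 'n) \<Rightarrow> nat \<Rightarrow> nat \<Rightarrow> nat \<Rightarrow> complex" where
  "X_entry \<psi> w i j k = cinner (\<psi> i j) (w i k)"

(* The choices entering the construction of the ensemble {q_i, sigma_i}. *)
definition admissible_choice ::
  "nat \<Rightarrow> (nat \<Rightarrow> nat) \<Rightarrow> (nat \<Rightarrow> real) \<Rightarrow> (nat \<Rightarrow> complex ^ 'n ^ 'n) \<Rightarrow> (nat \<Rightarrow> complex ^ 'n ^ 'n) \<Rightarrow>
   (nat \<Rightarrow> nat \<Rightarrow> complex ^ 'n) \<Rightarrow> (nat \<Rightarrow> nat \<Rightarrow> complex ^ 'n) \<Rightarrow> bool" where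
  "admissible_choice m r p \<rho> M \<psi> w \<longleftrightarrow>
     (\<forall>i\<in>{1..m}.
        p i *\<^sub>R \<rho> i = (\<Sum>j=1..r i. ketbra (\<psi> i j) (\<psi> i j)) \<and>
        orthonormal_basis_of (r i) (w i) (supp (M i)) \<and>
        psd_upto (r i) (X_entry \<psi> w i))"

definition chi ::
  "(nat \<Rightarrow> nat) \<Rightarrow> (nat \<Rightarrow> nat \<Rightarrow> complex ^ 'n) \<Rightarrow> (nat \<Rightarrow> nat \<Rightarrow> complex ^ 'n) \<Rightarrow>
   nat \<Rightarrow> nat \<Rightarrow> complex ^ 'n" where
  "chi r \<psi> w i j = (\<Sum>k=1..r i. X_entry \<psi> w i k j *s \<psi> i k)"

definition chi_weight ::
  "(nat \<Rightarrow> nat) \<Rightarrow> (nat \<Rightarrow> nat \<Rightarrow> complex ^ 'n) \<Rightarrow> (nat \<Rightarrow> nat \<Rightarrow> complex ^ 'n) \<Rightarrow> nat \<Rightarrow> real" where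
  "chi_weight r \<psi> w i = (\<Sum>j=1..r i. Re (cinner (chi r \<psi> w i j) (chi r \<psi> w i j)))"

definition Q_state ::
  "(nat \<Rightarrow> nat) \<Rightarrow> (nat \<Rightarrow> nat \<Rightarrow> complex ^ 'n) \<Rightarrow> (nat \<Rightarrow> nat \<Rightarrow> complex ^ 'n) \<Rightarrow>
   nat \<Rightarrow> complex ^ 'n ^ 'n" where
  "Q_state r \<psi> w i =
     (1 / chi_weight r \<psi> w i) *\<^sub>R (\<Sum>j=1..r i. ketbra (chi r \<psi> w i j) (chi r \<psi> w i j))"

definition Q_prob ::
  "nat \<Rightarrow> (nat \<Rightarrow> nat) \<Rightarrow> (nat \<Rightarrow> nat \<Rightarrow> complex ^ 'n) \<Rightarrow> (nat \<Rightarrow> nat \<Rightarrow> complex ^ 'n) \<Rightarrow> nat \<Rightarrow> real" where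
  "Q_prob m r \<psi> w i = chi_weight r \<psi> w i / (\<Sum>l=1..m. chi_weight r \<psi> w l)"

(* Pretty good measurement of an ensemble whose average state has full rank. *)
definition pgm ::
  "nat \<Rightarrow> (nat \<Rightarrow> real) \<Rightarrow> (nat \<Rightarrow> complex ^ 'n ^ 'n) \<Rightarrow> nat \<Rightarrow> complex ^ 'n ^ 'n" where
  "pgm m q \<sigma> i =
     inv_sqrt (\<Sum>j=1..m. q j *\<^sub>R \<sigma> j) ** (q i *\<^sub>R \<sigma> i) ** inv_sqrt (\<Sum>k=1..m. q k *\<^sub>R \<sigma> k)"

end

theory Submission
  imports Defs
begin

text \<open>
  Write \<open>A\<^sub>i = p\<^sub>i \<rho>\<^sub>i\<close>.  A variation of the optimal measurement shows that the
  Hermitian part \<open>G\<close> of \<open>\<Sum>\<^sub>i A\<^sub>i M\<^sub>i\<close> dominates every \<open>A\<^sub>i\<close>; since \<open>\<Sum>\<^sub>i tr ((G - A\<^sub>i) M\<^sub>i) = 0\<close>, each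
  \<open>G - A\<^sub>i\<close> annihilates the support of \<open>M\<^sub>i\<close>.  On the other hand \<open>\<chi>\<^sub>i\<^sub>j\<close> is just \<open>A\<^sub>i w\<^sub>i\<^sub>j\<close>, hence
  \<open>\<chi>\<^sub>i\<^sub>j = G w\<^sub>i\<^sub>j\<close>.  As \<open>M\<^sub>i\<close> is the projection \<open>\<Sum>\<^sub>j |w\<^sub>i\<^sub>j\<rangle>\<langle>w\<^sub>i\<^sub>j|\<close>, the operator \<open>q\<^sub>i \<sigma>\<^sub>i\<close> is \<open>G M\<^sub>i G\<close> up
  to a common factor, the average state is \<open>G\<^sup>2\<close> up to the same factor, and the pretty good
  measurement undoes the conjugation by \<open>G\<close>.
\<close>

section \<open>Algebra of the inner product, rank-one operators and traces\<close>

lemma cinner_add_right: "cinner u (v + v') = cinner u v + cinner u v'"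
  by (simp add: cinner_def algebra_simps sum.distrib)

lemma cinner_add_left: "cinner (u + u') v = cinner u v + cinner u' v"
  by (simp add: cinner_def algebra_simps sum.distrib)

lemma cinner_diff_right: "cinner u (v - v') = cinner u v - cinner u v'"
  by (simp add: cinner_def algebra_simps sum_subtractf)

lemma cinner_diff_left: "cinner (u - u') v = cinner u v - cinner u' v"
  by (simp add: cinner_def algebra_simps sum_subtractf)

lemma cinner_smult_right: "cinner u (c *s v) = c * cinner u v"
  by (simp add: cinner_def sum_distrib_left algebra_simps)

lemma cinner_smult_left: "cinner (c *s u) v = cnj c * cinner u v"
  by (simp add: cinner_def sum_distrib_left algebra_simps)

lemma cinner_scaleR_right: "cinner u (c *\<^sub>R v) = complex_of_real c * cinner u v"
  by (simp add: cinner_def sum_distrib_left) (simp add: scaleR_conv_of_real algebra_simps)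

lemma cinner_scaleR_left: "cinner (c *\<^sub>R u) v = complex_of_real c * cinner u v"
  by (simp add: cinner_def sum_distrib_left) (simp add: scaleR_conv_of_real algebra_simps)

lemma cinner_zero_right [simp]: "cinner u 0 = 0"
  by (simp add: cinner_def)

lemma cinner_zero_left [simp]: "cinner 0 v = 0"
  by (simp add: cinner_def)

lemma cinner_sum_right: "cinner u (sum f S) = (\<Sum>x\<in>S. cinner u (f x))"
  by (induction S rule: infinite_finite_induct) (auto simp: cinner_add_right)

lemma cnj_cinner: "cnj (cinner u v) = cinner v u"
  by (simp add: cinner_def mult.commute)

lemma cinner_self: "cinner v v = of_real ((norm v)\<^sup>2)"
proof -
  have "cinner v v = of_real (\<Sum>a\<in>UNIV. (norm (v $ a))\<^sup>2)"
    unfolding cinner_def of_real_sum complex_norm_square by (simp add: mult.commute)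
  then show ?thesis
    by (simp add: norm_vec_def L2_set_def sum_nonneg)
qed

lemma cinner_axis_left: "cinner (axis a 1) v = v $ a"
proof -
  have "cinner (axis a 1) v = (\<Sum>b\<in>UNIV. if b = a then v $ b else 0)"
    unfolding cinner_def by (intro sum.cong) (auto simp: axis_def)
  then show ?thesis by simp
qed

lemma scaleR_matrix_vector: "(c *\<^sub>R A) *v v = c *\<^sub>R (A *v v)"
  and matrix_vector_scaleR: "A *v (c *\<^sub>R v) = c *\<^sub>R (A *v v)"
  for A :: "complex ^ 'n ^ 'n"
  by (simp_all add: vec_eq_iff matrix_vector_mult_def scaleR_sum_right)

lemma sum_matrix_vector_mult: "sum F S *v v = (\<Sum>i\<in>S. F i *v v)"
  for F :: "'i \<Rightarrow> complex ^ 'n ^ 'n"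
  by (induction S rule: infinite_finite_induct) (auto simp: matrix_vector_mult_add_rdistrib)

lemma ketbra_mult_vec: "ketbra x y *v v = cinner y v *s x"
  by (simp add: vec_eq_iff ketbra_def matrix_vector_mult_def cinner_def sum_distrib_left algebra_simps)

lemma matrix_vector_axis: "(A *v axis a 1) $ b = A $ b $ a"
  for A :: "complex ^ 'n ^ 'n"
  by (simp add: matrix_vector_mult_def axis_def if_distrib cong: if_cong)

lemma trace_eq_cinner: "trace A = (\<Sum>a\<in>UNIV. cinner (axis a 1) (A *v axis a 1))"
  for A :: "complex ^ 'n ^ 'n"
  by (simp add: cinner_axis_left matrix_vector_axis trace_def)

lemma trace_sum: "trace (sum F S) = (\<Sum>i\<in>S. trace (F i))"
  for F :: "'i \<Rightarrow> complex ^ 'n ^ 'n"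
  by (induction S rule: infinite_finite_induct) (simp_all add: trace_add, simp_all add: trace_def)

lemma trace_scaleR: "trace (c *\<^sub>R A) = complex_of_real c * trace A"
  for A :: "complex ^ 'n ^ 'n"
  unfolding trace_def sum_distrib_left vector_scaleR_component by (simp only: scaleR_conv_of_real)

lemma matrix_mult_ketbra: "A ** ketbra x y = ketbra (A *v x) y"
  by (simp add: matrix_eq ketbra_mult_vec vec.scale flip: matrix_vector_mul_assoc)

lemma trace_ketbra: "trace (ketbra x y) = cinner y x"
  by (simp add: trace_def ketbra_def cinner_def mult.commute)

lemma matrix_add_rdistrib: "(A + B) ** C = A ** C + B ** C"
  for A B C :: "complex ^ 'n ^ 'n"
  by (simp add: matrix_eq matrix_vector_mult_add_rdistrib flip: matrix_vector_mul_assoc)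

lemma matrix_diff_ldistrib: "A ** (B - C) = A ** B - A ** C"
  for A B C :: "complex ^ 'n ^ 'n"
  by (simp add: matrix_eq matrix_vector_mult_diff_rdistrib vec.diff flip: matrix_vector_mul_assoc)

lemma matrix_diff_rdistrib: "(A - B) ** C = A ** C - B ** C"
  for A B C :: "complex ^ 'n ^ 'n"
  by (simp add: matrix_eq matrix_vector_mult_diff_rdistrib flip: matrix_vector_mul_assoc)

lemma matrix_mult_sum: "A ** sum F S = (\<Sum>i\<in>S. A ** F i)"
  for A :: "complex ^ 'n ^ 'n"
  by (induction S rule: infinite_finite_induct) (auto simp: matrix_add_ldistrib)

lemma sum_matrix_mult: "sum F S ** A = (\<Sum>i\<in>S. F i ** A)"
  for F :: "'i \<Rightarrow> complex ^ 'n ^ 'n" and A :: "complex ^ 'n ^ 'n"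
  by (induction S rule: infinite_finite_induct) (auto simp: matrix_add_rdistrib)

lemma matrix_mult_scaleR: "A ** (c *\<^sub>R B) = c *\<^sub>R (A ** B)" "(c *\<^sub>R A) ** B = c *\<^sub>R (A ** B)"
  for A B :: "complex ^ 'n ^ 'n"
  by (simp_all add: matrix_scalar_ac scalar_matrix_assoc)

section \<open>Positive semidefinite operators and uniqueness of their square roots\<close>

definition adj :: "complex ^ 'n ^ 'n \<Rightarrow> complex ^ 'n ^ 'n" where
  "adj A = (\<chi> a b. cnj (A $ b $ a))"

lemma cinner_adj: "cinner u (adj A *v v) = cinner (A *v u) v"
  unfolding cinner_def adj_def matrix_vector_mult_def
  by (simp add: sum_distrib_left sum_distrib_right algebra_simps) (rule sum.swap)

lemma cinner_psd:
  assumes "psd A"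
  shows "0 \<le> Re (cinner v (A *v v))" "Im (cinner v (A *v v)) = 0"
  using assms by (auto simp: psd_def complex_nonneg_Reals_iff)

text \<open>Polarization: the form is real at \<open>u + v\<close> and at
  \<open>u + \<i> *s v\<close>. The first fact gives the imaginary part of the identity, the second
  its real part.\<close>

lemma psd_hermitian:
  assumes "psd A"
  shows "cinner (A *v u) v = cinner u (A *v v)"
proof -
  note real = cinner_psd(2)[OF assms]
  have "Im (cinner u (A *v v) + cinner v (A *v u)) = 0"
    using real[of "u + v"] real[of u] real[of v]
    by (simp add: cinner_add_left cinner_add_right matrix_vector_right_distrib)
  moreover have "Re (cinner u (A *v v) - cinner v (A *v u)) = 0"
    using real[of "u + \<i> *s v"] real[of u] real[of v]
    by (simp add: cinner_add_left cinner_add_right matrix_vector_right_distrib vec.scale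
        cinner_smult_left cinner_smult_right)
  ultimately have "cnj (cinner v (A *v u)) = cinner u (A *v v)"
    by (simp add: complex_eq_iff)
  then show ?thesis by (simp add: cnj_cinner)
qed

text \<open>Division by \<open>t\<close> and passage to small \<open>t\<close>: the first-order test
  behind both \<open>psd_kernel\<close> and the variation of the measurement.\<close>

lemma linear_coeff_nonpos:
  fixes a b :: real
  assumes "\<And>t. 0 < t \<Longrightarrow> t \<le> 1 \<Longrightarrow> a * t \<le> b * t\<^sup>2"
  shows "a \<le> 0"
proof (rule ccontr)
  assume "\<not> a \<le> 0"
  then have a: "a > 0" by simp
  \<comment> \<open>This choice makes \<open>b * t\<close> at most \<open>a / 2\<close>; the added 1
    keeps the denominator positive when \<open>b = 0\<close>.\<close>
  define t where "t = min 1 (a / (2 * (\<bar>b\<bar> + 1)))"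
  have t: "0 < t" "t \<le> 1" using a by (auto simp: t_def)
  have "a * t \<le> (b * t) * t" using assms[OF t] by (simp add: power2_eq_square)
  then have "a \<le> b * t" using t by simp
  also have "\<dots> \<le> (\<bar>b\<bar> + 1) * t" using t by (intro mult_right_mono) auto
  also have "\<dots> \<le> (\<bar>b\<bar> + 1) * (a / (2 * (\<bar>b\<bar> + 1)))"
    by (intro mult_left_mono) (auto simp: t_def)
  also have "\<dots> = a / 2"
    by (simp add: divide_simps)
  finally show False using a by simp
qed

text \<open>The form vanishes at \<open>v\<close> and is nonnegative along the line in direction
  \<open>- (A *v v)\<close>. Its first-order coefficient there is minus twice the squared norm of
  \<open>A *v v\<close>, which must therefore be 0.\<close>

lemma psd_kernel:
  assumes "psd A" and "Re (cinner v (A *v v)) = 0"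
  shows "A *v v = 0"
proof -
  let ?w = "A *v v"
  have "2 * (norm ?w)\<^sup>2 * t \<le> Re (cinner ?w (A *v ?w)) * t\<^sup>2" for t
  proof -
    have "0 \<le> Re (cinner (v - t *\<^sub>R ?w) (A *v (v - t *\<^sub>R ?w)))"
      by (rule cinner_psd(1)[OF assms(1)])
    moreover have "cinner v (A *v ?w) = of_real ((norm ?w)\<^sup>2)"
      using psd_hermitian[OF assms(1), of v ?w] by (simp add: cinner_self)
    ultimately show ?thesis
      using assms(2)
      by (simp add: vec.diff matrix_vector_scaleR cinner_diff_left cinner_diff_right
          cinner_scaleR_left cinner_scaleR_right cinner_self power2_eq_square algebra_simps)
  qed
  then have "2 * (norm ?w)\<^sup>2 \<le> 0" by (rule linear_coeff_nonpos)
  then show ?thesis by simp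
qed

lemma psd_trace_nonneg: "psd A \<Longrightarrow> 0 \<le> Re (trace A)"
  by (simp add: trace_eq_cinner sum_nonneg cinner_psd(1))

text \<open>The diagonal entries are nonnegative with sum 0, so the form vanishes at each basis
  vector and \<open>psd_kernel\<close> makes every column 0.\<close>

lemma psd_trace_eq_0:
  assumes "psd A" and "Re (trace A) = 0"
  shows "A = 0"
proof -
  have "Re (cinner (axis a 1) (A *v axis a 1)) = 0" for a
    using assms(2) by (simp add: trace_eq_cinner sum_nonneg_eq_0_iff cinner_psd(1)[OF assms(1)])
  then have "A *v axis a 1 = 0" for a
    by (rule psd_kernel[OF assms(1)])
  then show ?thesis by (simp add: vec_eq_iff matrix_vector_axis)
qed

lemma psd_sandwich:
  assumes "psd A" and "\<And>u v. cinner (H *v u) v = cinner u (H *v v)"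
  shows "psd (H ** A ** H)"
  unfolding psd_def
proof
  fix v
  have "cinner v ((H ** A ** H) *v v) = cinner (H *v v) (A *v (H *v v))"
    by (simp add: assms(2) flip: matrix_vector_mul_assoc)
  then show "cinner v ((H ** A ** H) *v v) \<in> \<real>\<^sub>\<ge>\<^sub>0"
    using assms(1) by (simp add: psd_def)
qed

lemma psd_add: "psd A \<Longrightarrow> psd B \<Longrightarrow> psd (A + B)"
  by (simp add: psd_def matrix_vector_mult_add_rdistrib cinner_add_right)

lemma psd_scaleR: "psd A \<Longrightarrow> 0 \<le> c \<Longrightarrow> psd (c *\<^sub>R A)"
  by (auto simp: psd_def scaleR_matrix_vector cinner_scaleR_right complex_nonneg_Reals_iff)

lemma psd_ketbra: "psd (ketbra v v)"
proof -
  have "cinner x (ketbra v v *v x) = of_real ((cmod (cinner v x))\<^sup>2)" for x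
    unfolding complex_norm_square by (simp add: ketbra_mult_vec cinner_smult_right cnj_cinner)
  then show ?thesis by (simp add: psd_def)
qed

(* With D = B - C the hypothesis gives B D + D C = 0, so D B D and D C D have opposite traces. *)
lemma psd_square_root_unique:
  assumes B: "psd B" and C: "psd C" and sq: "B ** B = C ** C"
    and inj: "\<And>v. C *v v = 0 \<Longrightarrow> v = 0"
  shows "B = C"
proof -
  define D where "D = B - C"
  have herm: "cinner (D *v u) v = cinner u (D *v v)" for u v
    by (simp add: D_def matrix_vector_mult_diff_rdistrib cinner_diff_left cinner_diff_right
        psd_hermitian B C)
  have "B ** D + D ** C = 0"
    by (simp add: D_def matrix_diff_ldistrib matrix_diff_rdistrib sq)
  then have "trace (D ** (B ** D + D ** C)) = 0" by (simp add: trace_def)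
  then have "trace (D ** B ** D) + trace (D ** (D ** C)) = 0"
    by (simp add: matrix_add_ldistrib trace_add matrix_mul_assoc)
  moreover have "trace (D ** (D ** C)) = trace (D ** C ** D)"
    by (rule trace_mul_sym)
  ultimately have "Re (trace (D ** B ** D) + trace (D ** C ** D)) = 0" by simp
  then have "Re (trace (D ** B ** D)) + Re (trace (D ** C ** D)) = 0" by simp
  with psd_trace_nonneg[OF psd_sandwich[OF B herm]] psd_trace_nonneg[OF psd_sandwich[OF C herm]]
  have "Re (trace (D ** C ** D)) = 0" by linarith
  then have 0: "D ** C ** D = 0"
    using psd_trace_eq_0 psd_sandwich[OF C herm] by blast
  \<comment> \<open>Since \<open>D ** C ** D = 0\<close>, the form of \<open>C\<close> vanishes at
    \<open>D *v v\<close>; this vector lies in the kernel of \<open>C\<close>, which is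
    trivial.\<close>
  have "D *v v = 0" for v
  proof (rule inj, rule psd_kernel[OF C])
    have "cinner (D *v v) (C *v (D *v v)) = cinner v ((D ** C ** D) *v v)"
      by (simp add: herm flip: matrix_vector_mul_assoc)
    then show "Re (cinner (D *v v) (C *v (D *v v))) = 0" by (simp add: 0)
  qed
  then have "D = 0" by (simp add: matrix_eq)
  then show ?thesis by (simp add: D_def)
qed

lemma psd_sqrt_eqI:
  assumes "psd C" and "C ** C = A" and "\<And>v. C *v v = 0 \<Longrightarrow> v = 0"
  shows "psd_sqrt A = C"
  unfolding psd_sqrt_def
proof (rule the_equality)
  show "psd C \<and> C ** C = A" using assms(1,2) by simp
  show "B = C" if B: "psd B \<and> B ** B = A" for B
  proof (rule psd_square_root_unique)
    show "B ** B = C ** C" using B assms(2) by simp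
  qed (use B in blast, fact assms(1), fact assms(3))
qed

section \<open>First-order variation of the optimal measurement\<close>

text \<open>Expansion in powers of \<open>e\<close>. With \<open>P = ketbra v v\<close>, the traces
  of \<open>A ** P ** E\<close> and \<open>A ** E ** P\<close> are complex conjugates because
  \<open>A\<close> and \<open>E\<close> are Hermitian, hence the factor 2. The linear coefficient is
  the one that optimality constrains.\<close>

lemma trace_reflection_sandwich:
  fixes v :: "complex ^ 'n"
  assumes A: "psd A" and E: "psd E"
  defines "R \<equiv> \<lambda>e :: real. mat 1 - e *\<^sub>R ketbra v v"
  shows "Re (trace (A ** (R e ** E ** R e))) =
    Re (trace (A ** E)) - 2 * e * Re (cinner v (A *v (E *v v)))
      + e\<^sup>2 * (Re (cinner v (A *v v)) * Re (cinner v (E *v v)))"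
proof -
  let ?P = "ketbra v v"
  have RER: "R e ** E ** R e = E - e *\<^sub>R (?P ** E) - e *\<^sub>R (E ** ?P) + e\<^sup>2 *\<^sub>R (?P ** (E ** ?P))"
    unfolding R_def matrix_diff_ldistrib matrix_diff_rdistrib matrix_mult_scaleR matrix_mul_lid
      matrix_mul_rid scaleR_diff_right matrix_mul_assoc power2_eq_square scaleR_scaleR
    by simp
  have 1: "trace (A ** (E ** ?P)) = cinner v (A *v (E *v v))"
    by (simp add: matrix_mult_ketbra trace_ketbra)
  have "trace (A ** (?P ** E)) = trace (E ** (A ** ?P))"
    by (metis matrix_mul_assoc trace_mul_sym)
  also have "\<dots> = cnj (cinner v (A *v (E *v v)))"
    by (simp add: matrix_mult_ketbra trace_ketbra cnj_cinner psd_hermitian A E)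
  finally have 2: "trace (A ** (?P ** E)) = cnj (cinner v (A *v (E *v v)))" .
  have 3: "trace (A ** (?P ** (E ** ?P))) = cinner v (E *v v) * cinner v (A *v v)"
    by (simp add: matrix_mult_ketbra trace_ketbra ketbra_mult_vec vec.scale cinner_smult_right)
  have "trace (A ** (R e ** E ** R e)) = trace (A ** E)
      - e *\<^sub>R cnj (cinner v (A *v (E *v v))) - e *\<^sub>R cinner v (A *v (E *v v))
      + e\<^sup>2 *\<^sub>R (cinner v (E *v v) * cinner v (A *v v))"
    unfolding RER matrix_add_ldistrib matrix_diff_ldistrib matrix_mult_scaleR
      trace_add trace_sub trace_scaleR 1 2 3
    by (simp add: scaleR_conv_of_real)
  moreover have "Re (cinner v (E *v v) * cinner v (A *v v)) =
      Re (cinner v (A *v v)) * Re (cinner v (E *v v))"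
    by (simp add: cinner_psd A E)
  ultimately show ?thesis by simp
qed

(* Barnett and Croke's variation: conjugate every element by 1 - e |v><v| and give the
   missing weight e (2 - e) |v><v| to the j-th outcome. *)
lemma optimal_povm_variation_unit:
  assumes A: "\<And>i. i \<in> {1..m} \<Longrightarrow> psd (\<rho> i)"
    and opt: "optimal_povm m p \<rho> M" and j: "j \<in> {1..m}" and v: "norm v = 1"
  shows "p j * Re (cinner v (\<rho> j *v v)) \<le> (\<Sum>i=1..m. p i * Re (cinner v (\<rho> i *v (M i *v v))))"
proof -
  define R where "R e = mat 1 - e *\<^sub>R ketbra v v" for e :: real
  define M' where "M' e i = R e ** M i ** R e + (if i = j then (e * (2 - e)) *\<^sub>R ketbra v v else 0)" for e i
  define S where "S = (\<Sum>i=1..m. p i * Re (cinner v (\<rho> i *v (M i *v v))))"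
  define T where "T = (\<Sum>i=1..m. p i * (Re (cinner v (\<rho> i *v v)) * Re (cinner v (M i *v v))))"
  define b where "b = p j * Re (cinner v (\<rho> j *v v))"
  have M: "\<And>i. i \<in> {1..m} \<Longrightarrow> psd (M i)" "(\<Sum>i=1..m. M i) = mat 1"
    using opt by (auto simp: optimal_povm_def povm_def)
  have cvv: "cinner v v = 1" by (simp add: cinner_self v)
  have PP: "ketbra v v ** ketbra v v = ketbra v v"
    by (simp add: matrix_mult_ketbra ketbra_mult_vec cvv)
  have hermR: "cinner (R e *v x) y = cinner x (R e *v y)" for e x y
    by (simp add: R_def matrix_vector_mult_diff_rdistrib cinner_diff_left cinner_diff_right
        scaleR_matrix_vector cinner_scaleR_left cinner_scaleR_right psd_hermitian[OF psd_ketbra])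
  \<comment> \<open>The success probabilities of \<open>M' e\<close> and \<open>M\<close> are
    compared by powers of \<open>e\<close>: \<open>S\<close> and \<open>T\<close> come from the
    conjugation, \<open>b\<close> from the extra weight on outcome \<open>j\<close>.\<close>
  have "(2 * (b - S)) * e \<le> (b - T) * e\<^sup>2" if e: "0 < e" "e \<le> 1" for e
  proof -
    have "(\<Sum>i=1..m. R e ** M i ** R e) = R e ** (\<Sum>i=1..m. M i) ** R e"
      by (simp add: matrix_mult_sum sum_matrix_mult)
    then have "(\<Sum>i=1..m. M' e i) = R e ** R e + (e * (2 - e)) *\<^sub>R ketbra v v"
      using j M(2) by (simp add: M'_def sum.distrib)
    \<comment> \<open>As \<open>ketbra v v\<close> is idempotent, \<open>R e ** R e\<close> falls
      short of the identity by exactly \<open>e * (2 - e)\<close> times it.\<close>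
    also have "\<dots> = mat 1"
      by (simp add: R_def matrix_diff_ldistrib matrix_diff_rdistrib matrix_mult_scaleR PP)
        (simp add: vec_eq_iff, simp add: scaleR_conv_of_real algebra_simps)
    finally have "povm m (M' e)"
      using e by (auto simp: povm_def M'_def psd_add psd_scaleR psd_ketbra psd_sandwich hermR M(1))
    then have "success_prob m p \<rho> (M' e) \<le> success_prob m p \<rho> M"
      using opt by (simp add: optimal_povm_def)
    moreover have "p i * Re (trace (\<rho> i ** M' e i)) = p i * Re (trace (\<rho> i ** M i))
        - 2 * e * (p i * Re (cinner v (\<rho> i *v (M i *v v))))
        + e\<^sup>2 * (p i * (Re (cinner v (\<rho> i *v v)) * Re (cinner v (M i *v v))))
        + (if i = j then e * (2 - e) * b else 0)" if i: "i \<in> {1..m}" for i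
    proof -
      have tr: "Re (trace (\<rho> i ** M' e i)) = Re (trace (\<rho> i ** (R e ** M i ** R e)))
          + (if i = j then e * (2 - e) * Re (cinner v (\<rho> j *v v)) else 0)"
        by (simp add: M'_def matrix_add_ldistrib matrix_mult_scaleR trace_add trace_scaleR
            matrix_mult_ketbra trace_ketbra, simp add: trace_def)
      show ?thesis
        unfolding tr R_def trace_reflection_sandwich[OF A[OF i] M(1)[OF i]] b_def
        by (simp add: algebra_simps)
    qed
    then have "success_prob m p \<rho> (M' e) =
        success_prob m p \<rho> M - 2 * e * S + e\<^sup>2 * T + e * (2 - e) * b"
      using j by (simp add: success_prob_def S_def T_def sum.distrib sum_subtractf flip: sum_distrib_left)
    ultimately show ?thesis by (simp add: algebra_simps power2_eq_square)
  qed
  then have "2 * (b - S) \<le> 0" by (rule linear_coeff_nonpos)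
  then show ?thesis by (simp add: b_def S_def)
qed

text \<open>Both sides scale with the squared norm of \<open>v\<close>, so the inequality for unit
  vectors extends to all vectors.\<close>

lemma optimal_povm_variation:
  assumes "\<And>i. i \<in> {1..m} \<Longrightarrow> psd (\<rho> i)" and "optimal_povm m p \<rho> M" and "j \<in> {1..m}"
  shows "p j * Re (cinner v (\<rho> j *v v)) \<le> (\<Sum>i=1..m. p i * Re (cinner v (\<rho> i *v (M i *v v))))"
proof (cases "v = 0")
  case False
  define u where "u = inverse (norm v) *\<^sub>R v"
  have v: "v = norm v *\<^sub>R u" and "norm u = 1" using False by (simp_all add: u_def)
  have "(norm v)\<^sup>2 * (p j * Re (cinner u (\<rho> j *v u))) \<le>
      (norm v)\<^sup>2 * (\<Sum>i=1..m. p i * Re (cinner u (\<rho> i *v (M i *v u))))"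
    by (intro mult_left_mono optimal_povm_variation_unit assms \<open>norm u = 1\<close>) simp_all
  then show ?thesis
    by (subst (1 2 3 4) v)
      (simp add: matrix_vector_scaleR cinner_scaleR_left cinner_scaleR_right sum_distrib_left
        power2_eq_square algebra_simps)
qed simp

section \<open>The optimal measurement is projective\<close>

lemma psd_sum: "(\<And>i. i \<in> S \<Longrightarrow> psd (F i)) \<Longrightarrow> psd (sum F S)"
proof (induction S rule: infinite_finite_induct)
  case (insert x S)
  then show ?case by (simp add: psd_add)
qed (simp_all add: psd_def)

lemma cinner_span_eq_0:
  assumes "v \<in> vec.span B" and "\<And>b. b \<in> B \<Longrightarrow> cinner u b = 0"
  shows "cinner u v = 0"
  using assms(1)
  by (induction rule: vec.span_induct_alt)
    (simp_all add: assms(2) cinner_add_right cinner_smult_right)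

text \<open>A Hermitian operator maps into its support, so \<open>u\<close> is orthogonal to
  \<open>E *v u\<close> and \<open>psd_kernel\<close> applies.\<close>

lemma psd_orthogonal_supp:
  assumes E: "psd E" and u: "\<And>v. v \<in> supp E \<Longrightarrow> cinner u v = 0"
  shows "E *v u = 0"
proof (rule psd_kernel[OF E])
  have "E *v u \<in> supp E"
    by (auto simp: supp_def simp flip: psd_hermitian[OF E])
  then show "Re (cinner u (E *v u)) = 0" by (simp add: u)
qed

text \<open>With \<open>T\<close> the projection onto the support, \<open>E\<close> does not
  distinguish \<open>v\<close> from \<open>T *v v\<close>. The form of \<open>T - E\<close> at
  \<open>v\<close> is therefore that of \<open>mat 1 - E\<close> at \<open>T *v v\<close>.\<close>

lemma psd_projection_supp_minus:
  assumes E: "psd E" and E': "psd (mat 1 - E)" and w: "orthonormal_basis_of d w (supp E)"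
  shows "psd ((\<Sum>j=1..d. ketbra (w j) (w j)) - E)"
proof -
  define T where "T = (\<Sum>j=1..d. ketbra (w j) (w j))"
  have T: "T *v v = (\<Sum>j=1..d. cinner (w j) v *s w j)" for v
    by (simp add: T_def sum_matrix_vector_mult ketbra_mult_vec)
  have wT: "cinner (w k) (T *v v) = cinner (w k) v" if k: "k \<in> {1..d}" for k v
  proof -
    have "cinner (w k) (T *v v) = (\<Sum>j=1..d. if k = j then cinner (w j) v else 0)"
      unfolding T cinner_sum_right cinner_smult_right
      using w k by (intro sum.cong) (auto simp: orthonormal_basis_of_def)
    also have "\<dots> = cinner (w k) v" using k by simp
    finally show ?thesis .
  qed
  have TT: "T *v (T *v v) = T *v v" for v
    by (subst (1 3) T, intro sum.cong) (simp_all add: wT)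
  have "psd T" unfolding T_def by (intro psd_sum psd_ketbra)
  \<comment> \<open>The difference \<open>v - T *v v\<close> is orthogonal to every
    \<open>w j\<close>, hence to the support of \<open>E\<close>, and \<open>E\<close> annihilates
    it.\<close>
  have ET: "E *v (T *v v) = E *v v" for v
  proof -
    have "E *v (v - T *v v) = 0"
    proof (rule psd_orthogonal_supp[OF E])
      fix x assume "x \<in> supp E"
      then have x: "x \<in> vec.span (w ` {1..d})" using w by (simp add: orthonormal_basis_of_def)
      show "cinner (v - T *v v) x = 0"
      proof (rule cinner_span_eq_0[OF x])
        fix b assume "b \<in> w ` {1..d}"
        then have "cinner b (v - T *v v) = 0" by (auto simp: cinner_diff_right wT)
        then show "cinner (v - T *v v) b = 0" by (metis cnj_cinner complex_cnj_zero)
      qed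
    qed
    then show ?thesis by (simp add: vec.diff)
  qed
  have "cinner v ((T - E) *v v) = cinner (T *v v) ((mat 1 - E) *v (T *v v))" for v
  proof -
    have "cinner (T *v v) (E *v (T *v v)) = cinner v (E *v v)"
      by (metis ET E psd_hermitian)
    moreover have "cinner (T *v v) (T *v v) = cinner v (T *v v)"
      by (simp add: psd_hermitian[OF \<open>psd T\<close>] TT)
    ultimately show ?thesis
      by (simp add: matrix_vector_mult_diff_rdistrib cinner_diff_right)
  qed
  then show ?thesis
    using E' unfolding T_def[symmetric] psd_def by simp
qed

(* Each M i is dominated by the projection onto its support, and the rank condition makes
   the traces of the two families add up to the same number. *)
lemma povm_eq_projection:
  fixes M :: "nat \<Rightarrow> complex ^ 'n ^ 'n"
  assumes M: "povm m M" and r: "(\<Sum>i=1..m. r i) = CARD('n)"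
    and w: "\<And>i. i \<in> {1..m} \<Longrightarrow> orthonormal_basis_of (r i) (w i) (supp (M i))"
    and i: "i \<in> {1..m}"
  shows "M i = (\<Sum>j=1..r i. ketbra (w i j) (w i j))"
proof -
  define T where "T i = (\<Sum>j=1..r i. ketbra (w i j) (w i j))" for i
  have psdM: "psd (M i)" if "i \<in> {1..m}" for i using M that by (simp add: povm_def)
  have sumM: "(\<Sum>i=1..m. M i) = mat 1" using M by (simp add: povm_def)
  have psd: "psd (T i - M i)" if i: "i \<in> {1..m}" for i
    unfolding T_def
  proof (rule psd_projection_supp_minus[OF psdM[OF i] _ w[OF i]])
    \<comment> \<open>By completeness the complement of one element is the sum of the
      others.\<close>
    have "mat 1 - M i = (\<Sum>k\<in>{1..m} - {i}. M k)"
      using i by (simp add: sum_diff1 sumM[simplified])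
    also have "psd \<dots>" by (intro psd_sum psdM) simp
    finally show "psd (mat 1 - M i)" .
  qed
  have "trace (T i) = of_nat (r i)" if i: "i \<in> {1..m}" for i
  proof -
    have "trace (T i) = (\<Sum>j=1..r i. 1)"
      unfolding T_def trace_sum trace_ketbra
      by (intro sum.cong) (use w[OF i] in \<open>auto simp: orthonormal_basis_of_def\<close>)
    then show ?thesis by simp
  qed
  then have "(\<Sum>i=1..m. trace (T i)) = of_nat CARD('n)"
    by (simp flip: r)
  moreover have "(\<Sum>i=1..m. trace (M i)) = of_nat CARD('n)"
    by (simp only: sumM trace_I flip: trace_sum)
  ultimately have "(\<Sum>i=1..m. trace (T i - M i)) = 0"
    by (simp add: trace_sub sum_subtractf)
  then have sum0: "(\<Sum>i=1..m. Re (trace (T i - M i))) = 0"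
    by (metis Re_sum zero_complex.sel(1))
  have "Re (trace (T i - M i)) = 0"
    by (rule sum_nonneg_0[OF finite_atLeastAtMost _ sum0 i]) (intro psd_trace_nonneg psd)
  then have "T i - M i = 0" using psd_trace_eq_0 psd i by blast
  then show ?thesis by (simp add: T_def)
qed

section \<open>The dual operator and complementary slackness\<close>

lemma trace_adj: "trace (adj A) = cnj (trace A)"
  by (simp add: trace_def adj_def)

text \<open>These are the optimality conditions of a semidefinite program: \<open>G\<close> is dual
  feasible, by the variation inequality, and complementary slackness holds because the elements of
  \<open>M\<close> sum to the identity.\<close>

lemma optimal_povm_dual:
  assumes \<rho>: "\<And>i. i \<in> {1..m} \<Longrightarrow> psd (\<rho> i)" and opt: "optimal_povm m p \<rho> M"
  obtains G where "\<And>i. i \<in> {1..m} \<Longrightarrow> psd (G - p i *\<^sub>R \<rho> i)"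
    and "(\<Sum>i=1..m. Re (trace ((G - p i *\<^sub>R \<rho> i) ** M i))) = 0"
proof
  define Z where "Z = (\<Sum>i=1..m. (p i *\<^sub>R \<rho> i) ** M i)"
  \<comment> \<open>\<open>Z\<close> is not yet known to be Hermitian. Its Hermitian part has the
    real part of the form of \<open>Z\<close> as its form, so the form is real as \<open>psd\<close>
    demands.\<close>
  define G where "G = (1/2) *\<^sub>R (Z + adj Z)"
  have ReZ: "Re (cinner v (Z *v v)) = (\<Sum>i=1..m. p i * Re (cinner v (\<rho> i *v (M i *v v))))" for v
    by (simp add: Z_def sum_matrix_vector_mult cinner_sum_right matrix_mult_scaleR
        scaleR_matrix_vector cinner_scaleR_right flip: matrix_vector_mul_assoc)
  have G: "cinner v (G *v v) = of_real (Re (cinner v (Z *v v)))" for v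
    using cnj_cinner[of v "Z *v v"]
    by (simp add: G_def scaleR_matrix_vector matrix_vector_mult_add_rdistrib cinner_scaleR_right
        cinner_add_right cinner_adj complex_eq_iff)
  show "psd (G - p i *\<^sub>R \<rho> i)" if i: "i \<in> {1..m}" for i
    using optimal_povm_variation[OF \<rho> opt i] cinner_psd[OF \<rho>[OF i]]
    by (auto simp: psd_def matrix_vector_mult_diff_rdistrib scaleR_matrix_vector cinner_diff_right
        cinner_scaleR_right G ReZ complex_nonneg_Reals_iff)
  have "(\<Sum>i=1..m. trace ((G - p i *\<^sub>R \<rho> i) ** M i)) = trace (G ** (\<Sum>i=1..m. M i)) - trace Z"
    by (simp only: Z_def matrix_mult_sum matrix_diff_rdistrib trace_sum trace_sub sum_subtractf)
  also have "(\<Sum>i=1..m. M i) = mat 1" using opt by (simp add: optimal_povm_def povm_def)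
  finally have "(\<Sum>i=1..m. trace ((G - p i *\<^sub>R \<rho> i) ** M i)) = trace G - trace Z" by simp
  moreover have "Re (trace G) = Re (trace Z)"
    by (simp add: G_def trace_scaleR trace_add trace_adj)
  ultimately show "(\<Sum>i=1..m. Re (trace ((G - p i *\<^sub>R \<rho> i) ** M i))) = 0"
    by (metis Re_sum diff_self minus_complex.sel(1))
qed

section \<open>The constructed ensemble and its pretty good measurement\<close>

lemma matrix_inv_eqI:
  fixes A B :: "complex ^ 'n ^ 'n"
  assumes "B ** A = mat 1"
  shows "matrix_inv A = B"
proof -
  have "invertible A" using assms by (auto simp: invertible_left_inverse)
  then have "A ** matrix_inv A = mat 1"
    unfolding matrix_inv_def invertible_def by (rule someI2_ex) simp
  then have "B ** A ** matrix_inv A = B" by (simp flip: matrix_mul_assoc)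
  then show ?thesis by (simp add: assms)
qed

lemma ketbra_sandwich:
  assumes "psd G"
  shows "ketbra (G *v x) (G *v y) = G ** ketbra x y ** G"
  by (simp add: matrix_eq ketbra_mult_vec vec.scale psd_hermitian[OF assms] flip: matrix_vector_mul_assoc)

text \<open>The coefficients of \<open>chi\<close> are the inner products of the
  \<open>\<psi> i k\<close> with \<open>w i j\<close>, exactly those produced by applying the
  rank-one decomposition to \<open>w i j\<close>.\<close>

lemma chi_eq:
  assumes "p i *\<^sub>R \<rho> i = (\<Sum>j=1..r i. ketbra (\<psi> i j) (\<psi> i j))"
  shows "chi r \<psi> w i j = (p i *\<^sub>R \<rho> i) *v w i j"
  by (simp add: assms chi_def X_entry_def sum_matrix_vector_mult ketbra_mult_vec)

lemma chi_weight_eq_trace: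
  "chi_weight r \<psi> w i = Re (trace (\<Sum>j=1..r i. ketbra (chi r \<psi> w i j) (chi r \<psi> w i j)))"
  by (simp add: chi_weight_def trace_sum trace_ketbra)

text \<open>The weight of outcome \<open>i\<close> cancels. If it is 0, it is the zero trace of a
  positive sum; that sum is then 0, and so are both sides.\<close>

lemma Q_prob_scaleR_Q_state:
  "Q_prob m r \<psi> w i *\<^sub>R Q_state r \<psi> w i =
    (1 / (\<Sum>l=1..m. chi_weight r \<psi> w l)) *\<^sub>R (\<Sum>j=1..r i. ketbra (chi r \<psi> w i j) (chi r \<psi> w i j))"
proof (cases "chi_weight r \<psi> w i = 0")
  case True
  then have "(\<Sum>j=1..r i. ketbra (chi r \<psi> w i j) (chi r \<psi> w i j)) = 0"
    unfolding chi_weight_eq_trace by (intro psd_trace_eq_0 psd_sum psd_ketbra)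
  then show ?thesis by (simp add: Q_state_def)
qed (simp add: Q_prob_def Q_state_def)

text \<open>Such a \<open>v\<close> is orthogonal to every support. The supports span the space, so
  \<open>v\<close> is orthogonal to itself.\<close>

lemma ensemble_kernel:
  assumes "ensemble m r p \<rho>" and "\<And>i. i \<in> {1..m} \<Longrightarrow> \<rho> i *v v = 0"
  shows "v = 0"
proof -
  have "v \<in> vec.span (\<Union>i\<in>{1..m}. supp (\<rho> i))" using assms(1) by (simp add: ensemble_def)
  then have "cinner v v = 0"
    by (rule cinner_span_eq_0) (use assms(2) in \<open>auto simp: supp_def\<close>)
  then show ?thesis by (simp add: cinner_self)
qed

lemma optimal_povm_chi:
  assumes ens: "ensemble m r p \<rho>" and opt: "optimal_povm m p \<rho> M"
    and choice: "admissible_choice m r p \<rho> M \<psi> w"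
    and proj: "\<And>i. i \<in> {1..m} \<Longrightarrow> M i = (\<Sum>j=1..r i. ketbra (w i j) (w i j))"
    and m: "m \<noteq> 0"
  obtains G where "psd G" and "\<And>v. G *v v = 0 \<Longrightarrow> v = 0"
    and "\<And>i j. i \<in> {1..m} \<Longrightarrow> j \<in> {1..r i} \<Longrightarrow> chi r \<psi> w i j = G *v w i j"
proof -
  have \<rho>: "psd (\<rho> i)" "0 < p i" if "i \<in> {1..m}" for i
    using ens that by (simp_all add: ensemble_def density_operator_def)
  obtain G where G: "\<And>i. i \<in> {1..m} \<Longrightarrow> psd (G - p i *\<^sub>R \<rho> i)"
    and 0: "(\<Sum>i=1..m. Re (trace ((G - p i *\<^sub>R \<rho> i) ** M i))) = 0"
    using optimal_povm_dual[OF \<rho>(1) opt] by blast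
  show thesis
  proof (rule that)
    \<comment> \<open>Any single index exhibits \<open>G\<close> as a sum of two positive operators;
      index 1 exists because \<open>m\<close> is nonzero.\<close>
    have "psd (G - p 1 *\<^sub>R \<rho> 1 + p 1 *\<^sub>R \<rho> 1)"
      using m \<rho>[of 1] by (intro psd_add G psd_scaleR) auto
    then show "psd G" by simp
    show "v = 0" if v: "G *v v = 0" for v
    proof (rule ensemble_kernel[OF ens], rule psd_kernel)
      fix i assume i: "i \<in> {1..m}"
      \<comment> \<open>On the kernel of \<open>G\<close>, positivity of
        \<open>G - p i *\<^sub>R \<rho> i\<close> forces the form of each \<open>\<rho> i\<close> to
        be nonpositive.\<close>
      have "p i * Re (cinner v (\<rho> i *v v)) \<le> 0"
        using cinner_psd(1)[OF G[OF i], of v]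
        unfolding matrix_vector_mult_diff_rdistrib v scaleR_matrix_vector cinner_diff_right
          cinner_scaleR_right
        by simp
      then show "Re (cinner v (\<rho> i *v v)) = 0"
        using cinner_psd(1)[OF \<rho>(1)[OF i], of v] \<rho>(2)[OF i]
        by (simp add: mult_le_0_iff)
      show "psd (\<rho> i)" by (rule \<rho>(1)[OF i])
    qed
    show "chi r \<psi> w i j = G *v w i j" if i: "i \<in> {1..m}" and j: "j \<in> {1..r i}" for i j
    proof -
      \<comment> \<open>The slackness condition becomes a double sum of nonnegative terms equal to
        0, so each term vanishes and \<open>psd_kernel\<close> applies to it.\<close>
      define f where "f i j = Re (cinner (w i j) ((G - p i *\<^sub>R \<rho> i) *v w i j))" for i j
      have f: "0 \<le> f i j" if "i \<in> {1..m}" for i j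
        unfolding f_def by (rule cinner_psd(1)[OF G[OF that]])
      have "Re (trace ((G - p i *\<^sub>R \<rho> i) ** M i)) = (\<Sum>j=1..r i. f i j)" if "i \<in> {1..m}" for i
        by (simp add: proj[OF that] matrix_mult_sum matrix_mult_ketbra trace_sum trace_ketbra f_def)
      then have "(\<Sum>i=1..m. \<Sum>j=1..r i. f i j) = 0" using 0 by simp
      then have "(\<Sum>j=1..r i. f i j) = 0"
        using i by (subst (asm) sum_nonneg_eq_0_iff) (auto intro!: sum_nonneg f)
      then have "f i j = 0"
        using j by (subst (asm) sum_nonneg_eq_0_iff) (auto intro!: f i)
      then have "(G - p i *\<^sub>R \<rho> i) *v w i j = 0"
        unfolding f_def by (rule psd_kernel[OF G[OF i]])
      moreover have "chi r \<psi> w i j = (p i *\<^sub>R \<rho> i) *v w i j"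
        using choice i by (intro chi_eq) (simp add: admissible_choice_def)
      ultimately show ?thesis by (simp add: matrix_vector_mult_diff_rdistrib)
    qed
  qed
qed

text \<open>\<open>G\<close> divided by \<open>sqrt c\<close> is positive and injective and squares
  to the argument, so uniqueness identifies it as the square root.\<close>

lemma inv_sqrt_scaled_square:
  assumes G: "psd G" and inj: "\<And>v. G *v v = 0 \<Longrightarrow> v = 0" and H: "H ** G = mat 1" and c: "0 < c"
  shows "inv_sqrt ((1 / c) *\<^sub>R (G ** G)) = sqrt c *\<^sub>R H"
proof -
  have "psd_sqrt ((1 / c) *\<^sub>R (G ** G)) = (1 / sqrt c) *\<^sub>R G"
  proof (rule psd_sqrt_eqI)
    show "psd ((1 / sqrt c) *\<^sub>R G)" using c by (intro psd_scaleR G) simp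
    show "(1 / sqrt c) *\<^sub>R G ** (1 / sqrt c) *\<^sub>R G = (1 / c) *\<^sub>R (G ** G)"
      using c by (simp add: matrix_mult_scaleR)
    show "v = 0" if "((1 / sqrt c) *\<^sub>R G) *v v = 0" for v
      by (rule inj) (use that c in \<open>simp add: scaleR_matrix_vector\<close>)
  qed
  moreover have "matrix_inv ((1 / sqrt c) *\<^sub>R G) = sqrt c *\<^sub>R H"
    using c by (intro matrix_inv_eqI) (simp add: matrix_mult_scaleR H)
  ultimately show ?thesis by (simp add: inv_sqrt_def)
qed

theorem theorem3p1p4:
  fixes m :: nat and r :: "nat \<Rightarrow> nat"
    and p q :: "nat \<Rightarrow> real"
    and \<rho> M \<sigma> :: "nat \<Rightarrow> complex ^ 'n ^ 'n"
    and \<psi> w :: "nat \<Rightarrow> nat \<Rightarrow> complex ^ 'n"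
  assumes "rank_profile CARD('n) m r"
    and "ensemble m r p \<rho>"
    and "optimal_povm m p \<rho> M"
    and "admissible_choice m r p \<rho> M \<psi> w"
    and "\<And>i. i \<in> {1..m} \<Longrightarrow> \<sigma> i = Q_state r \<psi> w i"
    and "\<And>i. i \<in> {1..m} \<Longrightarrow> q i = Q_prob m r \<psi> w i"
  shows "\<forall>i\<in>{1..m}. M i = pgm m q \<sigma> i"
proof
  fix i assume i: "i \<in> {1..m}"
  have povm: "povm m M" using assms(3) by (simp add: optimal_povm_def)
  have proj: "M i = (\<Sum>j=1..r i. ketbra (w i j) (w i j))" if "i \<in> {1..m}" for i
    using povm _ _ that
  proof (rule povm_eq_projection)
    show "(\<Sum>i=1..m. r i) = CARD('n)" using assms(1) by (simp add: rank_profile_def)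
    show "orthonormal_basis_of (r i) (w i) (supp (M i))" if "i \<in> {1..m}" for i
      using assms(4) that by (simp add: admissible_choice_def)
  qed
  obtain G where G: "psd G" and inj: "\<And>v. G *v v = 0 \<Longrightarrow> v = 0"
    and chi: "\<And>i j. i \<in> {1..m} \<Longrightarrow> j \<in> {1..r i} \<Longrightarrow> chi r \<psi> w i j = G *v w i j"
    using optimal_povm_chi[OF assms(2-4) proj] i by (metis atLeastAtMost_iff le_zero_eq not_one_le_zero)
  obtain H where HG: "H ** G = mat 1"
    using inj matrix_left_invertible_ker[of G] by blast
  then have GH: "G ** H = mat 1" by (simp add: matrix_left_right_inverse)
  have sandwich: "(\<Sum>j=1..r i. ketbra (chi r \<psi> w i j) (chi r \<psi> w i j)) = G ** M i ** G"
    if i: "i \<in> {1..m}" for i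
    by (simp add: chi[OF i] ketbra_sandwich[OF G] proj[OF i] matrix_mult_sum sum_matrix_mult)
  \<comment> \<open>The common normalization of the ensemble turns out to be the trace of
    \<open>G ** G\<close>, positive because \<open>G\<close> is injective.\<close>
  define c where "c = (\<Sum>l=1..m. chi_weight r \<psi> w l)"
  have sum: "(\<Sum>i=1..m. G ** M i ** G) = G ** G"
    using povm by (simp add: povm_def flip: matrix_mult_sum sum_matrix_mult)
  have "chi_weight r \<psi> w i = Re (trace (G ** M i ** G))" if "i \<in> {1..m}" for i
    by (simp only: chi_weight_eq_trace sandwich[OF that])
  then have "c = Re (trace (G ** G))"
    by (simp add: c_def trace_sum flip: sum)
  \<comment> \<open>The identity is inserted to give \<open>G ** G\<close> the shape required by
    \<open>psd_sandwich\<close>.\<close>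
  moreover have "psd (G ** mat 1 ** G)"
    by (intro psd_sandwich psd_hermitian[OF G]) (simp add: psd_def cinner_self)
  moreover have "G ** G \<noteq> 0"
  proof
    assume "G ** G = 0"
    \<comment> \<open>Any basis vector serves as a nonzero vector here, hence the index
      \<open>undefined\<close>.\<close>
    then have "G *v (G *v axis undefined 1) = 0"
      by (simp add: matrix_vector_mul_assoc)
    then have "axis undefined (1 :: complex) = (0 :: complex ^ 'n)" by (rule inj[OF inj])
    then show False by simp
  qed
  ultimately have c: "0 < c"
    using psd_trace_nonneg[of "G ** G"] psd_trace_eq_0[of "G ** G"] by (auto simp: less_le)
  have q\<sigma>: "q i *\<^sub>R \<sigma> i = (1 / c) *\<^sub>R (G ** M i ** G)" if "i \<in> {1..m}" for i
    using that by (simp only: assms(5,6) Q_prob_scaleR_Q_state sandwich c_def)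
  have avg: "(\<Sum>j=1..m. q j *\<^sub>R \<sigma> j) = (1 / c) *\<^sub>R (G ** G)"
    by (simp add: q\<sigma> flip: scaleR_sum_right sum)
  have "pgm m q \<sigma> i = (sqrt c *\<^sub>R H) ** ((1 / c) *\<^sub>R (G ** M i ** G)) ** (sqrt c *\<^sub>R H)"
    by (simp only: pgm_def avg inv_sqrt_scaled_square[OF G inj HG c] q\<sigma>[OF i])
  \<comment> \<open>The two factors \<open>sqrt c\<close> cancel \<open>1 / c\<close>.\<close>
  also have "\<dots> = (H ** G) ** M i ** (G ** H)"
    using c by (simp add: matrix_mult_scaleR matrix_mul_assoc)
  also have "\<dots> = M i" by (simp add: HG GH)
  finally show "M i = pgm m q \<sigma> i" by simp
qed

end
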